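(* Thompson's group $F = \langle x_0, x_1 \mid [x_0x_1^{-1},\, x_0^{-1}x_1x_0],\ [x_0x_1^{-1},\, x_0^{-2}x_1x_0^{2}]\rangle$ is not combable by geodesics with respect to the generating set $\{x_0,x_1\}$; that is, there do not exist a constant $k$ and a choice, for each $w\in F$, of a geodesic path $\gamma_w$ from the identity to $w$ in the Cayley graph $\Gamma(F,\{x_0,x_1\})$, such that the collection $\{\gamma_w\}_{w\in F}$ satisfies the $k$-fellow traveller property.
   Context: In the Cayley graph $\Gamma=\Gamma(F,\{x_0,x_1\})$, with vertex set $F$, vertices $v$ and $vg$ are joined by an edge for $g\in\{x_0^{\pm1},x_1^{\pm1}\}$; $d_\Gamma$ is the resulting word metric. A path $\gamma$ from the identity to $w$, written as a product $\prod_{i=1}^n g_i$ of elements $g_i \in\{x_0^{\pm1},x_1^{\pm1}\}$, is viewed as an eventually constant map $\mathbb{Z}^+\to F$ by $\gamma(i)=\prod_{j=1}^i g_j$ for $i\le n$ and $\gamma(i)=w$ for $i>n$. It is geodesic if $n$ is the word length of $w$. The synchronous distance between two such paths $\gamma,\eta$ is $D_s(\gamma,\eta)=\max_{i\in\mathbb{Z}^+} d_\Gamma(\gamma(i),\eta(i))$. Two paths $\gamma$ and $\eta$ from the identity to $w$ and $v$, with $d_\Gamma(w,v)=1$, are said to $k$-fellow travel if $D_s(\gamma,\eta)\le k$. A collection of paths (exactly one path for each group element) satisfies the $k$-fellow traveller property if every pair of its paths ending at vertices at distance one $k$-fellow travel, with the same constant $k$. *)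

theory Defs
  imports "HOL-Algebra.Group"
begin

text \<open>Group presentations. A word over the alphabet \<open>'a\<close> is a list of signed letters:
  \<open>(a, True)\<close> stands for \<open>a\<close>, and \<open>(a, False)\<close> for its formal inverse.\<close>

type_synonym 'a gword = "('a \<times> bool) list"

definition word_inv :: "'a gword \<Rightarrow> 'a gword" where
  "word_inv w = rev (map (\<lambda>(a, s). (a, \<not> s)) w)"

text \<open>The commutator convention is irrelevant for a relator: with the convention
  \<open>u\<^sup>-\<^sup>1 v\<^sup>-\<^sup>1 u v\<close> the relation likewise says that \<open>u\<close> and \<open>v\<close> commute.\<close>

definition word_commutator :: "'a gword \<Rightarrow> 'a gword \<Rightarrow> 'a gword" where
  "word_commutator u v = u @ v @ word_inv u @ word_inv v"

text \<open>Equality of words in the group presented by the relators \<open>R\<close>: the least congruence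
  for concatenation that contains free cancellation and makes every relator trivial.\<close>

inductive pres_eq :: "'a gword set \<Rightarrow> 'a gword \<Rightarrow> 'a gword \<Rightarrow> bool"
  for R :: "'a gword set" where
  refl: "pres_eq R u u"
| sym: "pres_eq R u v \<Longrightarrow> pres_eq R v u"
| trans: "pres_eq R u v \<Longrightarrow> pres_eq R v w \<Longrightarrow> pres_eq R u w"
| append: "pres_eq R u u' \<Longrightarrow> pres_eq R v v' \<Longrightarrow> pres_eq R (u @ v) (u' @ v')"
| cancel: "pres_eq R [(a, s), (a, \<not> s)] []"
| relator: "r \<in> R \<Longrightarrow> pres_eq R r []"

definition pres_class :: "'a gword set \<Rightarrow> 'a gword \<Rightarrow> 'a gword set" where
  "pres_class R u = {v. pres_eq R u v}"

definition presented_group :: "'a gword set \<Rightarrow> 'a gword set monoid" where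
  "presented_group R =
     \<lparr>carrier = range (pres_class R),
      mult = (\<lambda>A B. \<Union>u\<in>A. \<Union>v\<in>B. pres_class R (u @ v)),
      one = pres_class R []\<rparr>"

lemma pres_class_eq_iff: "pres_class R u = pres_class R v \<longleftrightarrow> pres_eq R u v"
proof
  assume "pres_class R u = pres_class R v"
  then show "pres_eq R u v"
    using pres_eq.refl[of R v] by (auto simp: pres_class_def)
next
  assume "pres_eq R u v"
  then show "pres_class R u = pres_class R v"
    unfolding pres_class_def by (blast intro: pres_eq.sym pres_eq.trans)
qed

lemma carrier_presented_group: "carrier (presented_group R) = range (pres_class R)"
  by (simp add: presented_group_def)

lemma one_presented_group: "\<one>\<^bsub>presented_group R\<^esub> = pres_class R []"
  by (simp add: presented_group_def)

lemma mult_presented_group: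
  "pres_class R u \<otimes>\<^bsub>presented_group R\<^esub> pres_class R v = pres_class R (u @ v)"
proof -
  have eq: "pres_class R (u' @ v') = pres_class R (u @ v)"
    if "u' \<in> pres_class R u" "v' \<in> pres_class R v" for u' v'
    unfolding pres_class_eq_iff
    by (rule pres_eq.sym, rule pres_eq.append) (use that in \<open>simp_all add: pres_class_def\<close>)
  have u: "u \<in> pres_class R u" and v: "v \<in> pres_class R v"
    by (simp_all add: pres_class_def pres_eq.refl)
  have "(\<Union>u'\<in>pres_class R u. \<Union>v'\<in>pres_class R v. pres_class R (u' @ v'))
      = (\<Union>u'\<in>pres_class R u. \<Union>v'\<in>pres_class R v. pres_class R (u @ v))"
    by (intro SUP_cong HOL.refl eq)
  also have "\<dots> = pres_class R (u @ v)"
    using u v by blast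
  finally show ?thesis
    by (simp add: presented_group_def)
qed

lemma pres_eq_inv_left: "pres_eq R (word_inv u @ u) []"
proof (induction u)
  case Nil
  show ?case by (simp add: word_inv_def pres_eq.refl)
next
  case (Cons x u)
  obtain a s where x: "x = (a, s)" by force
  have "pres_eq R [(a, \<not> s), (a, s)] []"
    using pres_eq.cancel[of R a "\<not> s"] by simp
  then have "pres_eq R (word_inv u @ [(a, \<not> s), (a, s)] @ u) (word_inv u @ [] @ u)"
    by (intro pres_eq.append pres_eq.refl)
  then show ?case
    using pres_eq.trans[OF _ Cons.IH] by (simp add: word_inv_def x)
qed

lemma group_presented_group: "group (presented_group R)" (is "group ?G")
proof (rule groupI)
  fix x y assume "x \<in> carrier ?G" "y \<in> carrier ?G"
  then obtain u v where "x = pres_class R u" "y = pres_class R v"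
    unfolding carrier_presented_group by blast
  then show "x \<otimes>\<^bsub>?G\<^esub> y \<in> carrier ?G"
    by (simp only: carrier_presented_group mult_presented_group rangeI)
next
  show "\<one>\<^bsub>?G\<^esub> \<in> carrier ?G"
    by (simp only: carrier_presented_group one_presented_group rangeI)
next
  fix x y z assume "x \<in> carrier ?G" "y \<in> carrier ?G" "z \<in> carrier ?G"
  then obtain u v w where "x = pres_class R u" "y = pres_class R v" "z = pres_class R w"
    unfolding carrier_presented_group by blast
  then show "x \<otimes>\<^bsub>?G\<^esub> y \<otimes>\<^bsub>?G\<^esub> z = x \<otimes>\<^bsub>?G\<^esub> (y \<otimes>\<^bsub>?G\<^esub> z)"
    by (simp only: mult_presented_group append_assoc)
next
  fix x assume "x \<in> carrier ?G"
  then obtain u where u: "x = pres_class R u"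
    unfolding carrier_presented_group by blast
  show "\<one>\<^bsub>?G\<^esub> \<otimes>\<^bsub>?G\<^esub> x = x"
    by (simp only: u mult_presented_group one_presented_group append_Nil)
  have "pres_class R (word_inv u) \<otimes>\<^bsub>?G\<^esub> x = \<one>\<^bsub>?G\<^esub>"
    by (simp only: u mult_presented_group one_presented_group pres_class_eq_iff pres_eq_inv_left)
  then show "\<exists>y\<in>carrier ?G. y \<otimes>\<^bsub>?G\<^esub> x = \<one>\<^bsub>?G\<^esub>"
    unfolding carrier_presented_group by blast
qed


text \<open>Cayley graphs, for a group \<open>G\<close> and a set \<open>S\<close> of generators.\<close>

definition sym_gens :: "('g, 'm) monoid_scheme \<Rightarrow> 'g set \<Rightarrow> 'g set" where
  "sym_gens G S = S \<union> (m_inv G ` S)"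

definition cayley_adj :: "('g, 'm) monoid_scheme \<Rightarrow> 'g set \<Rightarrow> 'g \<Rightarrow> 'g \<Rightarrow> bool" where
  "cayley_adj G S v w \<longleftrightarrow> v \<in> carrier G \<and> (\<exists>g\<in>sym_gens G S. w = v \<otimes>\<^bsub>G\<^esub> g)"

text \<open>The number of edges of a shortest edge path; only meaningful when \<open>S\<close> generates \<open>G\<close>,
  so that the graph is connected.\<close>

definition cayley_dist :: "('g, 'm) monoid_scheme \<Rightarrow> 'g set \<Rightarrow> 'g \<Rightarrow> 'g \<Rightarrow> nat" where
  "cayley_dist G S v w = (LEAST n. (cayley_adj G S ^^ n) v w)"

definition list_prod :: "('g, 'm) monoid_scheme \<Rightarrow> 'g list \<Rightarrow> 'g" where
  "list_prod G gs = foldr (mult G) gs \<one>\<^bsub>G\<^esub>"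

text \<open>A path from the identity to \<open>w\<close> is the list \<open>[g\<^sub>1, \<dots>, g\<^sub>n]\<close> of the generators it reads.\<close>

definition path_to :: "('g, 'm) monoid_scheme \<Rightarrow> 'g set \<Rightarrow> 'g \<Rightarrow> 'g list \<Rightarrow> bool" where
  "path_to G S w gs \<longleftrightarrow> set gs \<subseteq> sym_gens G S \<and> list_prod G gs = w"

definition word_length :: "('g, 'm) monoid_scheme \<Rightarrow> 'g set \<Rightarrow> 'g \<Rightarrow> nat" where
  "word_length G S w = (LEAST n. \<exists>gs. path_to G S w gs \<and> length gs = n)"

definition geodesic_to :: "('g, 'm) monoid_scheme \<Rightarrow> 'g set \<Rightarrow> 'g \<Rightarrow> 'g list \<Rightarrow> bool" where
  "geodesic_to G S w gs \<longleftrightarrow> path_to G S w gs \<and> length gs = word_length G S w"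

text \<open>The eventually constant map of a path: for \<open>i\<close> beyond the length, \<open>take i gs = gs\<close>.\<close>

definition path_at :: "('g, 'm) monoid_scheme \<Rightarrow> 'g list \<Rightarrow> nat \<Rightarrow> 'g" where
  "path_at G gs i = list_prod G (take i gs)"

definition sync_dist :: "('g, 'm) monoid_scheme \<Rightarrow> 'g set \<Rightarrow> 'g list \<Rightarrow> 'g list \<Rightarrow> nat" where
  "sync_dist G S gs hs = Max ((\<lambda>i. cayley_dist G S (path_at G gs i) (path_at G hs i)) ` {1..})"

lemma finite_sync_dist:
  "finite ((\<lambda>i. cayley_dist G S (path_at G gs i) (path_at G hs i)) ` {1..})"
proof (rule finite_subset)
  let ?f = "\<lambda>i. cayley_dist G S (path_at G gs i) (path_at G hs i)"
  let ?N = "max (length gs) (length hs)"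
  have eq: "?f i = ?f (min i ?N)" for i
    by (cases "i \<le> ?N") (simp_all add: path_at_def)
  show "?f ` {1..} \<subseteq> ?f ` {..?N}"
  proof (rule image_subsetI)
    fix i
    have "min i ?N \<in> {..?N}" by simp
    then show "?f i \<in> ?f ` {..?N}"
      by (rule image_eqI[where f = ?f, OF eq])
  qed
qed simp

definition fellow_traveller_property ::
    "('g, 'm) monoid_scheme \<Rightarrow> 'g set \<Rightarrow> nat \<Rightarrow> ('g \<Rightarrow> 'g list) \<Rightarrow> bool" where
  "fellow_traveller_property G S k \<gamma> \<longleftrightarrow>
     (\<forall>w\<in>carrier G. \<forall>v\<in>carrier G.
        cayley_dist G S w v = 1 \<longrightarrow> sync_dist G S (\<gamma> w) (\<gamma> v) \<le> k)"

definition combable_by_geodesics :: "('g, 'm) monoid_scheme \<Rightarrow> 'g set \<Rightarrow> bool" where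
  "combable_by_geodesics G S \<longleftrightarrow>
     (\<exists>k \<gamma>. (\<forall>w\<in>carrier G. geodesic_to G S w (\<gamma> w)) \<and> fellow_traveller_property G S k \<gamma>)"


datatype thompson_gen = X0 | X1

abbreviation (input) word_x0 :: "thompson_gen gword" where "word_x0 \<equiv> [(X0, True)]"
abbreviation (input) word_x1 :: "thompson_gen gword" where "word_x1 \<equiv> [(X1, True)]"

definition thompson_relators :: "thompson_gen gword set" where
  "thompson_relators =
     {word_commutator (word_x0 @ word_inv word_x1)
        (word_inv word_x0 @ word_x1 @ word_x0),
      word_commutator (word_x0 @ word_inv word_x1)
        (word_inv word_x0 @ word_inv word_x0 @ word_x1 @ word_x0 @ word_x0)}"

definition thompson_F :: "thompson_gen gword set monoid" where
  "thompson_F = presented_group thompson_relators"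

definition x0 :: "thompson_gen gword set" where
  "x0 = pres_class thompson_relators word_x0"

definition x1 :: "thompson_gen gword set" where
  "x1 = pres_class thompson_relators word_x1"

lemma inv_presented_group:
  "inv\<^bsub>presented_group R\<^esub> (pres_class R u) = pres_class R (word_inv u)"
proof -
  interpret group "presented_group R" by (rule group_presented_group)
  show ?thesis
    by (rule inv_equality)
      (simp_all add: mult_presented_group one_presented_group pres_class_eq_iff
        pres_eq_inv_left carrier_presented_group rangeI)
qed

text \<open>The two elements generate, so word lengths are not vacuous minima.\<close>

lemma thompson_F_path_exists:
  assumes "w \<in> carrier thompson_F"
  shows "\<exists>gs. path_to thompson_F {x0, x1} w gs"
proof -
  let ?c = "pres_class thompson_relators"
  have letter: "?c [y] \<in> sym_gens thompson_F {x0, x1}" for y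
  proof -
    obtain a s where y: "y = (a, s)" by force
    show ?thesis
      by (cases a; cases s)
        (auto simp: y sym_gens_def x0_def x1_def thompson_F_def inv_presented_group word_inv_def)
  qed
  obtain u where u: "w = ?c u"
    using assms by (auto simp: thompson_F_def carrier_presented_group)
  have "list_prod thompson_F (map (\<lambda>y. ?c [y]) u) = ?c u"
    by (induction u)
      (simp_all add: list_prod_def thompson_F_def one_presented_group mult_presented_group)
  then have "path_to thompson_F {x0, x1} w (map (\<lambda>y. ?c [y]) u)"
    using letter by (auto simp: path_to_def u)
  then show ?thesis by blast
qed

end

theory Submission
  imports Defs "HOL-Library.Stream"
begin

text \<open>
  The obstruction is a family of \<^emph>\<open>seesaw words\<close> \<open>w\<close>, one for each \<open>K\<close>, of length \<open>n = 5 K +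
  2\<close>. A geodesic to \<open>w\<close> must end in \<open>x\<^sub>0\<^sup>K\<close> or in \<open>x\<^sub>0\<^sup>-\<^sup>K\<close>, and both occur. As soon as the
  last letter is fixed, the other \<open>K - 1\<close> are forced: every geodesic to \<open>w x\<^sub>0\<close> passes through
  \<open>w x\<^sub>0\<^sup>K\<close> at time \<open>n - K\<close>, and every geodesic to \<open>w x\<^sub>0\<^sup>-\<^sup>1\<close> passes through \<open>w x\<^sub>0\<^sup>-\<^sup>K\<close> at
  that time. Whichever of the two ends the chosen geodesic to \<open>w\<close> visits, one neighbour of \<open>w\<close>
  has a geodesic that visits the other end, and the two ends are \<open>2 K\<close> apart. So no constant
  bounds the distance between geodesics with adjacent endpoints.

  To see why \<open>w\<close> behaves like this, let \<open>F\<close> act on the right on bi-infinite rows of binary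
  trees with a pointer: \<open>x\<^sub>0\<close> moves the pointer one tree to the left, and \<open>x\<^sub>1\<^sup>-\<^sup>1\<close> joins the
  current tree with its right neighbour by a caret. The word \<open>w\<close> adds one caret far to the left
  (at distance \<open>K\<close> from the pointer), adds \<open>K\<close> carets on the trees to the right of the pointer,
  and comes back. It can do the left excursion or the right excursion first, since they commute
  (\<open>excursions_commute\<close>), and the walk that stops at the end of the second excursion does not
  pay for the way back.

  That nothing shorter is possible follows from a potential function, the length formula of
  Belk and Brown for forest diagrams: a sum over the gaps between consecutive leaves, with a
  weight that depends on where the gap lies in the tree row and in the original row. One letter
  changes the potential by at most one (\<open>window_step\<close>), so it bounds word length from below
  (\<open>length_ge_window_cost\<close>). On \<open>w x\<^sub>0\<^sup>\<plusminus>\<^sup>j\<close> it is at least \<open>n - j\<close>, while multiplying once more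
  by \<open>x\<^sub>1\<close> or its inverse raises it (\<open>seesaw_length_ge\<close>, \<open>seesaw_x1_length_ge\<close>); hence the last
  letters of a geodesic are forced.
\<close>

section \<open>Thompson's group acting on rows of trees\<close>

text \<open>
  A leaf records its origin: \<open>Root n\<close> is the \<open>n\<close>-th point of the original row, and \<open>Lo\<close>, \<open>Hi\<close>
  are the two halves of a subdivided point. Thus a row of trees with its leaf addresses is a
  forest diagram, the addresses being the bottom forest.
\<close>

datatype addr = Root int | Lo addr | Hi addr
datatype tree = Leaf addr | Node tree tree

text \<open>
  Cancelling a caret against a subdivision makes pairing a bijection between pairs of reduced
  trees and reduced trees. So \<open>x\<^sub>1\<close> and its inverse undo each other on rows of reduced trees,
  and the group acts on these rows themselves instead of on classes of diagrams up to
  reduction.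
\<close>

fun join :: "tree \<Rightarrow> tree \<Rightarrow> tree" where
  "join (Leaf (Lo a)) (Leaf (Hi b)) = (if a = b then Leaf a else Node (Leaf (Lo a)) (Leaf (Hi b)))"
| "join s t = Node s t"

fun fst_half :: "tree \<Rightarrow> tree" where
  "fst_half (Leaf a) = Leaf (Lo a)" | "fst_half (Node s t) = s"

fun snd_half :: "tree \<Rightarrow> tree" where
  "snd_half (Leaf a) = Leaf (Hi a)" | "snd_half (Node s t) = t"

fun reduced :: "tree \<Rightarrow> bool" where
  "reduced (Leaf a) \<longleftrightarrow> True"
| "reduced (Node s t) \<longleftrightarrow> reduced s \<and> reduced t \<and> join s t = Node s t"

lemma halves_join [simp]: "fst_half (join s t) = s" "snd_half (join s t) = t"
  by (cases "(s, t)" rule: join.cases; simp)+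

lemma join_halves [simp]: "reduced t \<Longrightarrow> join (fst_half t) (snd_half t) = t"
  by (cases t) auto

lemma reduced_halves [simp]: "reduced t \<Longrightarrow> reduced (fst_half t)" "reduced t \<Longrightarrow> reduced (snd_half t)"
  by (cases t; simp)+

lemma reduced_join [simp]: "reduced s \<Longrightarrow> reduced t \<Longrightarrow> reduced (join s t)"
  by (cases "(s, t)" rule: join.cases) auto

text \<open>
  The first stream starts with the tree under the pointer and continues to the left; the second
  one starts with the right neighbour of the pointer and continues to the right.
\<close>

type_synonym state = "tree stream \<times> tree stream"

fun step :: "state \<Rightarrow> thompson_gen \<times> bool \<Rightarrow> state" where
  "step (t ## L, R) (X0, True) = (L, t ## R)"
| "step (L, t ## R) (X0, False) = (t ## L, R)"
| "step (t ## L, R) (X1, True) = (fst_half t ## L, snd_half t ## R)"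
| "step (s ## L, t ## R) (X1, False) = (join s t ## L, R)"

definition act :: "state \<Rightarrow> thompson_gen gword \<Rightarrow> state" where
  "act = foldl step"

lemma act_simps [simp]:
  "act s [] = s" "act s (y # u) = act (step s y) u" "act s (u @ v) = act (act s u) v"
  by (simp_all add: act_def)

definition red_state :: "state \<Rightarrow> bool" where
  "red_state s \<longleftrightarrow> (\<forall>t \<in> sset (fst s) \<union> sset (snd s). reduced t)"

lemma red_state_step: "red_state s \<Longrightarrow> red_state (step s y)"
  by (cases "(s, y)" rule: step.cases) (auto simp: red_state_def)

lemma red_state_act: "red_state s \<Longrightarrow> red_state (act s u)"
  by (induction u arbitrary: s) (auto simp: red_state_step)

lemma step_cancel:
  assumes "red_state s"
  shows "step (step s (a, b)) (a, \<not> b) = s"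
proof -
  obtain l L r R where "s = (l ## L, r ## R)"
    by (metis prod.collapse stream.collapse)
  with assms show ?thesis
    by (cases a; cases b) (auto simp: red_state_def)
qed

text \<open>
  The relators only see the three trees next to the pointer on either side, so each of them is
  checked by running it on six generic trees.
\<close>

lemma act_relator:
  assumes "red_state s" "r \<in> thompson_relators"
  shows "act s r = s"
proof -
  obtain l0 l1 l2 L r0 r1 r2 R where "s = (l0 ## l1 ## l2 ## L, r0 ## r1 ## r2 ## R)"
    by (metis prod.collapse stream.collapse)
  with assms show ?thesis
    by (auto simp: thompson_relators_def word_commutator_def word_inv_def red_state_def)
qed

lemma act_pres_eq:
  assumes "pres_eq thompson_relators u v" "red_state s"
  shows "act s u = act s v"
  using assms
proof (induction arbitrary: s)
  case (append u u' v v')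
  then show ?case by (simp add: red_state_act)
qed (simp_all add: step_cancel act_relator)

section \<open>A lower bound for word length\<close>

text \<open>
  Every leaf stands for the gap on its left, labelled by the leaf's address as in the length
  formula of Belk and Brown: outside all trees and left of the pointer (\<open>Out_L\<close>), outside and
  right of it (\<open>Out_R\<close>), inside a tree and immediately followed by a caret (\<open>In_N\<close>), inside a
  tree otherwise (\<open>In_I\<close>). Their label N also contains the outside gaps right of the pointer
  that precede a caret, but as those have the same weights as the other gaps counted by
  \<open>Out_R\<close>, the label depends on a single address.
\<close>

datatype gap = Out_L | Out_R | In_N | In_I

fun lo_gap :: "gap \<Rightarrow> gap" where
  "lo_gap Out_L = Out_L" | "lo_gap Out_R = Out_R" | "lo_gap In_N = In_N" | "lo_gap In_I = In_N"

fun addr_gap :: "addr \<Rightarrow> gap" where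
  "addr_gap (Root n) = (if n \<le> 0 then Out_L else Out_R)"
| "addr_gap (Lo a) = lo_gap (addr_gap a)"
| "addr_gap (Hi a) = In_I"

text \<open>
  The Belk-Brown weight of a gap with the given labels in the row of trees and in the original
  row, plus one for each of the two labels that is inner. A tree has as many inner gaps as
  carets, so this also counts the carets of both forests.
\<close>

fun cost :: "gap \<Rightarrow> gap \<Rightarrow> nat" where
  "cost Out_L Out_L = 2" | "cost Out_L Out_R = 1" | "cost Out_L In_N = 2" | "cost Out_L In_I = 2"
| "cost Out_R Out_L = 1" | "cost Out_R Out_R = 2" | "cost Out_R In_N = 3" | "cost Out_R In_I = 1"
| "cost In_N Out_L = 2" | "cost In_N Out_R = 3" | "cost In_N In_N = 4" | "cost In_N In_I = 2"
| "cost In_I Out_L = 2" | "cost In_I Out_R = 1" | "cost In_I In_N = 2" | "cost In_I In_I = 2"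

fun tree_cost :: "gap \<Rightarrow> tree \<Rightarrow> nat" where
  "tree_cost x (Leaf a) = cost x (addr_gap a)"
| "tree_cost x (Node s t) = tree_cost (lo_gap x) s + tree_cost In_I t"

fun first_gap :: "tree \<Rightarrow> gap" where
  "first_gap (Leaf a) = addr_gap a" | "first_gap (Node s t) = first_gap s"

text \<open>
  The three comparisons below are the effects of a letter on the label of one gap: \<open>x\<^sub>0\<close>
  exchanges \<open>Out_L\<close> and \<open>Out_R\<close>, while \<open>x\<^sub>1\<close> exchanges an outer gap right of the pointer with
  an inner one.
\<close>

lemma cost_Out_L_Out_R: "cost Out_L x \<le> cost Out_R x + 1" "cost Out_R x \<le> cost Out_L x + 1"
  by (cases x; simp)+

lemma cost_In_N: "cost In_N x = cost Out_R x + 1"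
  by (cases x) simp_all

lemma cost_Out_R_In_I: "cost Out_R x \<le> cost In_I x + 1" "cost In_I x \<le> cost Out_R x + 1"
  by (cases x; simp)+

lemma tree_cost_Out_L_Out_R:
  "tree_cost Out_L t \<le> tree_cost Out_R t + 1" "tree_cost Out_R t \<le> tree_cost Out_L t + 1"
  by (induction t) (use cost_Out_L_Out_R in auto)

lemma tree_cost_In_N: "tree_cost In_N t = tree_cost Out_R t + 1"
  by (induction t) (simp_all add: cost_In_N)

lemma tree_cost_Out_R_In_I:
  "tree_cost Out_R t \<le> tree_cost In_I t + 1" "tree_cost In_I t \<le> tree_cost Out_R t + 1"
  by (cases t; use cost_Out_R_In_I in \<open>simp add: tree_cost_In_N\<close>)+

lemma tree_cost_Out_L_first: "first_gap t = Out_L \<Longrightarrow> tree_cost Out_L t = tree_cost Out_R t + 1"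
  by (induction t) auto

definition ups :: "int \<Rightarrow> tree stream" where
  "ups n = smap (\<lambda>i. Leaf (Root i)) (siterate (\<lambda>i. i + 1) n)"
definition downs :: "int \<Rightarrow> tree stream" where
  "downs n = smap (\<lambda>i. Leaf (Root i)) (siterate (\<lambda>i. i - 1) n)"

lemma ups_unfold: "ups n = Leaf (Root n) ## ups (n + 1)"
  unfolding ups_def by (subst siterate.code) simp
lemma downs_unfold: "downs n = Leaf (Root n) ## downs (n - 1)"
  unfolding downs_def by (subst siterate.code) simp

text \<open>
  A window is a finite part of the row outside which nothing has happened. The bounds on \<open>d\<close>
  and \<open>e\<close> and the nonempty left part ensure that both rows give the same label to each gap
  outside. The gap to the left of its first leaf lies outside the region visited; the condition
  on the leftmost tree says that this gap has label \<open>Out_L\<close> in both rows and so costs the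
  constant 2. Windows are not required to be minimal, which makes them easy to enlarge when the
  pointer runs out of them.
\<close>

definition window :: "state \<Rightarrow> tree list \<Rightarrow> tree list \<Rightarrow> bool" where
  "window s ls rs \<longleftrightarrow> ls \<noteq> [] \<and> first_gap (last ls) = Out_L \<and>
     (\<exists>d e. d \<le> 0 \<and> 1 \<le> e \<and> s = (ls @- downs d, rs @- ups e))"

definition window_cost :: "tree list \<Rightarrow> tree list \<Rightarrow> nat" where
  "window_cost ls rs = sum_list (map (tree_cost Out_L) ls) + sum_list (map (tree_cost Out_R) rs)"

text \<open>
  One letter changes a single gap label, or creates or destroys a gap together with a caret of
  the original row, where relabelling the gap at the pointer is free; the table of costs is
  made so that this is a change by at most one. When the letter needs a tree beyond the window,
  the window is first enlarged by an untouched leaf of cost 2, and the letter turns this 2 into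
  1.
\<close>

lemma window_step:
  assumes "window s ls rs"
  shows "\<exists>ls' rs'. window (step s y) ls' rs' \<and> window_cost ls' rs' \<le> window_cost ls rs + 1"
proof -
  obtain t ls0 d e where ls: "ls = t # ls0" and kl: "first_gap (last (t # ls0)) = Out_L"
    and d: "d \<le> 0" and e: "1 \<le> e" and s: "s = (t ## ls0 @- downs d, rs @- ups e)"
    using assms unfolding window_def by (metis neq_Nil_conv shift.simps)
  have w: "window s' ls' rs'" if "ls' \<noteq> []" "first_gap (last ls') = Out_L" "d' \<le> 0" "1 \<le> e'"
    "s' = (ls' @- downs d', rs' @- ups e')" for s' ls' rs' d' e'
    using that unfolding window_def by blast
  obtain a b where y: "y = (a, b)" by force
  consider "y = (X0, True)" | "y = (X0, False)" | "y = (X1, True)" | "y = (X1, False)"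
    using y by (cases a; cases b) auto
  then show ?thesis
  proof cases
    case 1
    show ?thesis
    proof (cases "ls0 = []")
      case True
      have "window (step s y) [Leaf (Root d)] (t # rs)"
        by (rule w[of _ "d - 1" e]) (use d e in \<open>simp_all add: s 1 True downs_unfold[of d]\<close>)
      moreover have "window_cost [Leaf (Root d)] (t # rs) \<le> window_cost ls rs + 1"
        using kl d tree_cost_Out_L_first[of t] by (simp add: window_cost_def ls True)
      ultimately show ?thesis by blast
    next
      case False
      have "window (step s y) ls0 (t # rs)"
        by (rule w[of _ d e]) (use d e kl False in \<open>simp_all add: s 1\<close>)
      moreover have "window_cost ls0 (t # rs) \<le> window_cost ls rs + 1"
        using tree_cost_Out_L_Out_R(2)[of t] by (simp add: window_cost_def ls)
      ultimately show ?thesis by blast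
    qed
  next
    case 2
    show ?thesis
    proof (cases rs)
      case Nil
      have "window (step s y) (Leaf (Root e) # ls) []"
        by (rule w[of _ d "e + 1"]) (use d e kl in \<open>simp_all add: s 2 ls Nil ups_unfold[of e]\<close>)
      moreover have "window_cost (Leaf (Root e) # ls) [] \<le> window_cost ls rs + 1"
        using e by (simp add: window_cost_def Nil)
      ultimately show ?thesis by blast
    next
      case (Cons r rs0)
      have "window (step s y) (r # ls) rs0"
        by (rule w[of _ d e]) (use d e kl in \<open>simp_all add: s 2 ls Cons\<close>)
      moreover have "window_cost (r # ls) rs0 \<le> window_cost ls rs + 1"
        using tree_cost_Out_L_Out_R(1)[of r] by (simp add: window_cost_def Cons)
      ultimately show ?thesis by blast
    qed
  next
    case 3
    have "window (step s y) (fst_half t # ls0) (snd_half t # rs)"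
      by (rule w[of _ d e]) (use d e kl in \<open>cases t; simp add: s 3 split: if_splits\<close>)+
    moreover have "window_cost (fst_half t # ls0) (snd_half t # rs) \<le> window_cost ls rs + 1"
    proof (cases t)
      case (Leaf a)
      then show ?thesis by (cases "addr_gap a") (simp_all add: window_cost_def ls)
    next
      case (Node l r)
      then show ?thesis using tree_cost_Out_R_In_I(1)[of r] by (simp add: window_cost_def ls)
    qed
    ultimately show ?thesis by blast
  next
    case 4
    show ?thesis
    proof (cases rs)
      case Nil
      have "window (step s y) (Node t (Leaf (Root e)) # ls0) []"
        by (rule w[of _ d "e + 1"]) (use d e kl in \<open>simp_all add: s 4 Nil ups_unfold[of e] split: if_splits\<close>)
      moreover have "window_cost (Node t (Leaf (Root e)) # ls0) [] \<le> window_cost ls rs + 1"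
        using e by (simp add: window_cost_def Nil ls)
      ultimately show ?thesis by blast
    next
      case (Cons r rs0)
      have k: "first_gap (join t r) = Out_L" if "first_gap t = Out_L"
        using that by (cases "(t, r)" rule: join.cases) (auto elim: lo_gap.elims)
      have "window (step s y) (join t r # ls0) rs0"
        by (rule w[of _ d e]) (use d e kl k in \<open>simp_all add: s 4 Cons split: if_splits\<close>)
      moreover have "tree_cost Out_L (join t r) \<le> tree_cost Out_L t + tree_cost Out_R r + 1"
      proof (cases "join t r = Node t r")
        case True
        then show ?thesis using tree_cost_Out_R_In_I(2)[of r] by simp
      next
        case False
        then obtain a where "t = Leaf (Lo a)" "r = Leaf (Hi a)"
          by (cases "(t, r)" rule: join.cases) (auto split: if_splits)
        then show ?thesis by (cases "addr_gap a") simp_all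
      qed
      then have "window_cost (join t r # ls0) rs0 \<le> window_cost ls rs + 1"
        by (simp add: window_cost_def Cons ls)
      ultimately show ?thesis by blast
    qed
  qed
qed

definition start :: state where "start = (downs 0, ups 1)"

lemma red_state_start: "red_state start"
  by (auto simp: red_state_def start_def ups_def downs_def stream.set_map)

text \<open>The summand 2 pays for the gap left of the window.\<close>

lemma window_act:
  "\<exists>ls rs. window (act start u) ls rs \<and> window_cost ls rs \<le> length u + 2"
proof (induction u rule: rev_induct)
  case Nil
  have "window start [Leaf (Root 0)] []"
    unfolding window_def
    by (rule conjI, simp, rule conjI, simp, rule exI[of _ "-1"], rule exI[of _ 1])
      (simp add: start_def downs_unfold[of 0])
  moreover have "window_cost [Leaf (Root 0)] [] = 2"
    by (simp add: window_cost_def)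
  ultimately show ?case by (metis act_simps(1) add_0 list.size(3) order_refl)
next
  case (snoc y u)
  then obtain ls rs where "window (act start u) ls rs" "window_cost ls rs \<le> length u + 2" by blast
  with window_step[of "act start u" ls rs y] show ?case by fastforce
qed

text \<open>
  All trees outside a window are leaves, so a window cannot end before the outermost proper tree.
\<close>

lemma shift_eq_imp_prefix:
  assumes "xs @- S = ys @- T" "xs = [] \<or> last xs \<notin> sset T"
  shows "\<exists>zs. ys = xs @ zs"
  using assms
proof (induction xs arbitrary: ys)
  case (Cons x xs)
  show ?case
  proof (cases ys)
    case Nil
    with Cons.prems(1) have "T = (x # xs) @- S" by simp
    then have "sset T = set (x # xs) \<union> sset S" by (simp only: sset_shift)
    with Cons.prems(2) have False using last_in_set[of "x # xs"] by blast
    then show ?thesis ..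
  next
    case (Cons y ys')
    with Cons.prems Cons.IH[of ys'] show ?thesis by (cases "xs = []") auto
  qed
qed simp

text \<open>
  If a finite part of the row is bounded by proper trees, then every window contains it and
  costs at least as much. Therefore its cost bounds the length of all words for the same group
  element.
\<close>

lemma length_ge_window_cost:
  assumes "pres_eq thompson_relators u v"
    and "act start u = (ls @- L, rs @- R)"
    and "ls \<noteq> []" "\<And>a. last ls \<noteq> Leaf a" and "rs = [] \<or> (\<forall>a. last rs \<noteq> Leaf a)"
  shows "window_cost ls rs \<le> length v + 2"
proof -
  obtain ls' rs' where w: "window (act start v) ls' rs'" and c: "window_cost ls' rs' \<le> length v + 2"
    using window_act by blast
  have "act start v = (ls @- L, rs @- R)"
    using act_pres_eq[OF assms(1) red_state_start] assms(2) by simp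
  with w obtain d e where eq: "ls @- L = ls' @- downs d" "rs @- R = rs' @- ups e"
    unfolding window_def by auto
  have "last ls \<notin> sset (downs d)" "rs = [] \<or> last rs \<notin> sset (ups e)"
    using assms(4,5) by (auto simp: downs_def ups_def stream.set_map)
  then obtain xs ys where "ls' = ls @ xs" "rs' = rs @ ys"
    using shift_eq_imp_prefix[OF eq(1)] shift_eq_imp_prefix[OF eq(2)] by blast
  with c show ?thesis by (simp add: window_cost_def)
qed

section \<open>Commuting elements obtained from the two relations\<close>

context group
begin

definition conj_by :: "'a \<Rightarrow> 'a \<Rightarrow> 'a" where
  "conj_by g a = inv g \<otimes> a \<otimes> g"

definition commute :: "'a \<Rightarrow> 'a \<Rightarrow> bool" where
  "commute a b \<longleftrightarrow> a \<otimes> b = b \<otimes> a"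

lemma cancel_inv [simp]:
  assumes "g \<in> carrier G" "a \<in> carrier G"
  shows "g \<otimes> (inv g \<otimes> a) = a" "inv g \<otimes> (g \<otimes> a) = a"
  using assms by (simp_all add: m_assoc [symmetric])

lemma conj_by_closed [simp]:
  "g \<in> carrier G \<Longrightarrow> a \<in> carrier G \<Longrightarrow> conj_by g a \<in> carrier G"
  by (simp add: conj_by_def)

lemma conj_by_mult:
  assumes "g \<in> carrier G" "h \<in> carrier G" "a \<in> carrier G"
  shows "conj_by (g \<otimes> h) a = conj_by h (conj_by g a)"
  using assms by (simp add: conj_by_def inv_mult_group m_assoc)

lemma conj_by_conj_by:
  assumes "g \<in> carrier G" "h \<in> carrier G" "a \<in> carrier G"
  shows "conj_by g (conj_by h a) = conj_by (conj_by g h) (conj_by g a)"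
  using assms by (simp add: conj_by_def inv_mult_group m_assoc)

lemma commute_conj_by:
  assumes "g \<in> carrier G" "a \<in> carrier G" "b \<in> carrier G" "commute a b"
  shows "commute (conj_by g a) (conj_by g b)"
proof -
  have "conj_by g a \<otimes> conj_by g b = inv g \<otimes> (a \<otimes> b) \<otimes> g"
    "conj_by g b \<otimes> conj_by g a = inv g \<otimes> (b \<otimes> a) \<otimes> g"
    using assms(1-3) by (simp_all add: conj_by_def m_assoc)
  with assms(4) show ?thesis by (simp add: commute_def)
qed

lemma commute_mult:
  assumes "a \<in> carrier G" "b \<in> carrier G" "c \<in> carrier G" "commute a b" "commute a c"
  shows "commute a (b \<otimes> c)"
  using assms unfolding commute_def by (metis m_assoc)

lemma commute_inv:
  assumes "a \<in> carrier G" "b \<in> carrier G" "commute a b"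
  shows "commute a (inv b)"
  using assms unfolding commute_def by (metis inv_closed inv_solve_left inv_solve_right m_assoc m_closed)

lemma conj_by_eq_iff_commute:
  assumes "x \<in> carrier G" "y \<in> carrier G" "a \<in> carrier G"
  shows "conj_by x a = conj_by y a \<longleftrightarrow> commute (x \<otimes> inv y) a"
proof -
  have "conj_by x a = conj_by y a \<longleftrightarrow> x \<otimes> conj_by x a \<otimes> inv y = x \<otimes> conj_by y a \<otimes> inv y"
    using assms by simp
  also have "x \<otimes> conj_by x a \<otimes> inv y = a \<otimes> (x \<otimes> inv y)"
    using assms by (simp add: conj_by_def m_assoc)
  also have "x \<otimes> conj_by y a \<otimes> inv y = (x \<otimes> inv y) \<otimes> a"
    using assms by (simp add: conj_by_def m_assoc)
  finally show ?thesis by (auto simp: commute_def)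
qed

text \<open>
  With \<open>Y\<^sub>n\<close> for \<open>y\<close> conjugated by \<open>x\<^sup>n\<close>, the commutation of \<open>x y\<^sup>-\<^sup>1\<close> with \<open>Y\<^sub>n\<close> means that
  \<open>x\<close> and \<open>y\<close> conjugate \<open>Y\<^sub>n\<close> to the same element \<open>Y\<^sub>n\<^sub>+\<^sub>1\<close>. This extends from \<open>n = 1, 2\<close> to
  all positive \<open>n\<close>, because the case \<open>n\<close> expresses \<open>Y\<^sub>n\<^sub>+\<^sub>2\<close> as the conjugate of \<open>Y\<^sub>n\<^sub>+\<^sub>1\<close> by
  \<open>Y\<^sub>1\<close>, and both of these are treated alike by \<open>x\<close> and \<open>y\<close>.
\<close>

lemma conj_by_pow_eq:
  fixes x y :: 'a
  assumes x: "x \<in> carrier G" and y: "y \<in> carrier G"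
  defines "Y n \<equiv> conj_by (x [^] (n::nat)) y"
  assumes Y1: "commute (x \<otimes> inv y) (Y 1)" and Y2: "commute (x \<otimes> inv y) (Y 2)"
  shows "conj_by x (Y (Suc n)) = conj_by y (Y (Suc n))"
proof -
  have Y: "Y n \<in> carrier G" for n
    using x y by (simp add: Y_def)
  have Y_Suc: "Y (Suc n) = conj_by x (Y n)" for n
    using x y by (simp add: Y_def conj_by_mult)
  have E1: "conj_by x (Y 1) = conj_by y (Y 1)" and E2: "conj_by x (Y 2) = conj_by y (Y 2)"
    using Y1 Y2 x y Y by (simp_all add: conj_by_eq_iff_commute)
  have Y_1: "Y 1 = conj_by x y"
    using x y by (simp add: Y_def)
  have "conj_by x (Y (Suc n)) = conj_by y (Y (Suc n)) \<and>
      conj_by x (Y (Suc (Suc n))) = conj_by y (Y (Suc (Suc n)))"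
  proof (induction n)
    case 0
    show ?case using E1 E2 by (simp add: numeral_2_eq_2)
  next
    case (Suc n)
    have "Y (Suc (Suc (Suc n))) = conj_by x (conj_by y (Y (Suc n)))"
      using Suc.IH by (simp only: Y_Suc[of "Suc (Suc n)"] Y_Suc[of "Suc n"])
    also have "\<dots> = conj_by (Y 1) (Y (Suc (Suc n)))"
      unfolding conj_by_conj_by[OF x y Y] Y_1 Y_Suc[of "Suc n"] ..
    finally have rec: "Y (Suc (Suc (Suc n))) = conj_by (Y 1) (Y (Suc (Suc n)))" .
    have "conj_by x (Y (Suc (Suc (Suc n)))) = conj_by y (Y (Suc (Suc (Suc n))))"
      unfolding rec conj_by_conj_by[OF x Y Y] conj_by_conj_by[OF y Y Y]
      using Suc.IH E1 by (simp only:)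
    with Suc.IH show ?case by blast
  qed
  then show ?thesis ..
qed

text \<open>
  The second element is the product of the inverses of \<open>Y\<^sub>1, \<dots>, Y\<^sub>n\<close>, and the first one is a
  conjugate of \<open>x y\<^sup>-\<^sup>1\<close> that brings each of these into the situation of the previous lemma.
\<close>

lemma thompson_relations_commute:
  fixes x y :: 'a
  assumes x: "x \<in> carrier G" and y: "y \<in> carrier G"
    and Y1: "commute (x \<otimes> inv y) (conj_by x y)"
    and Y2: "commute (x \<otimes> inv y) (conj_by (x \<otimes> x) y)"
  shows "commute (x [^] Suc m \<otimes> inv y \<otimes> inv x [^] m) ((inv x \<otimes> inv y) [^] n \<otimes> x [^] (n::nat))"
    (is "commute ?a _")
proof -
  define Y where "Y n = conj_by (x [^] (n::nat)) y" for n
  have Y [simp]: "Y n \<in> carrier G" for n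
    using x y by (simp add: Y_def)
  have a: "?a = conj_by (inv x [^] m) (x \<otimes> inv y)"
    using x y by (simp add: conj_by_def nat_pow_inv m_assoc)
  have ac [simp]: "?a \<in> carrier G"
    using x y by simp
  have z: "commute (x \<otimes> inv y) (Y (Suc n))" for n
    using conj_by_pow_eq[OF x y] Y1 Y2 x y Y
    by (simp add: Y_def conj_by_eq_iff_commute numeral_2_eq_2)
  have aY: "commute ?a (Y (Suc n))" for n
  proof -
    have "x [^] (Suc n + m) \<otimes> inv x [^] m = x [^] Suc n"
      using x by (simp add: nat_pow_inv m_assoc del: nat_pow_Suc add_Suc flip: nat_pow_mult)
    then have "Y (Suc n) = conj_by (inv x [^] m) (Y (Suc (n + m)))"
      using x y conj_by_mult[of "x [^] Suc (n + m)" "inv x [^] m" y]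
      by (simp add: Y_def del: nat_pow_Suc)
    then show ?thesis
      unfolding a using x y z by (simp add: commute_conj_by)
  qed
  show ?thesis
  proof (induction n)
    case 0
    show ?case using ac by (simp add: commute_def)
  next
    case (Suc n)
    have "inv (x [^] Suc n) = inv (x [^] n) \<otimes> inv x"
      unfolding nat_pow_Suc2[OF x] using x by (simp add: inv_mult_group)
    moreover have "x [^] n \<otimes> x = x \<otimes> x [^] n"
      using nat_pow_Suc2[OF x, of n] by simp
    ultimately have "(inv x \<otimes> inv y) [^] Suc n \<otimes> x [^] Suc n
        = ((inv x \<otimes> inv y) [^] n \<otimes> x [^] n) \<otimes> inv (Y (Suc n))"
      using x y by (simp add: Y_def conj_by_def inv_mult_group m_assoc)
    with Suc.IH aY[of n] show ?case
      using x y ac by (simp add: commute_mult commute_inv del: nat_pow_Suc)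
  qed
qed

end

section \<open>Seesaw words\<close>

abbreviation cls :: "thompson_gen gword \<Rightarrow> thompson_gen gword set" where
  "cls \<equiv> pres_class thompson_relators"

abbreviation shifts :: "bool \<Rightarrow> nat \<Rightarrow> thompson_gen gword" where
  "shifts e n \<equiv> replicate n (X0, e)"

text \<open>
  The extra step to the left lets the caret join the trees at \<open>- K - 1\<close> and \<open>- K\<close>; the joined
  tree is at distance \<open>K\<close> from the pointer again.
\<close>

definition left_excursion :: "nat \<Rightarrow> thompson_gen gword" where
  "left_excursion K = shifts True (Suc K) @ [(X1, False)] @ shifts False K"

definition right_excursion :: "nat \<Rightarrow> thompson_gen gword" where
  "right_excursion K = concat (replicate K [(X0, False), (X1, False)]) @ shifts True K"

definition seesaw :: "nat \<Rightarrow> thompson_gen gword" where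
  "seesaw K = left_excursion K @ right_excursion K"

interpretation F: group thompson_F
  unfolding thompson_F_def by (rule group_presented_group)

lemma cls_closed [simp]: "cls u \<in> carrier thompson_F"
  by (simp add: thompson_F_def carrier_presented_group)

lemma cls_append: "cls (u @ v) = cls u \<otimes>\<^bsub>thompson_F\<^esub> cls v"
  by (simp add: thompson_F_def mult_presented_group)

lemma cls_word_inv: "cls (word_inv u) = inv\<^bsub>thompson_F\<^esub> cls u"
  by (simp add: thompson_F_def inv_presented_group)

lemma cls_concat_replicate: "cls (concat (replicate n u)) = cls u [^]\<^bsub>thompson_F\<^esub> n"
proof (induction n)
  case 0
  show ?case by (simp add: thompson_F_def one_presented_group)
next
  case (Suc n)
  then show ?case using F.nat_pow_Suc2[of "cls u" n] by (simp add: cls_append del: F.nat_pow_Suc)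
qed

lemma cls_eq_iff: "cls u = cls v \<longleftrightarrow> pres_eq thompson_relators u v"
  by (rule pres_class_eq_iff)

lemma cls_letter:
  "cls [(X0, True)] = x0" "cls [(X0, False)] = inv\<^bsub>thompson_F\<^esub> x0"
  "cls [(X1, True)] = x1" "cls [(X1, False)] = inv\<^bsub>thompson_F\<^esub> x1"
  by (simp_all add: x0_def x1_def word_inv_def flip: cls_word_inv)

lemma x_closed [simp]: "x0 \<in> carrier thompson_F" "x1 \<in> carrier thompson_F"
  by (simp_all add: x0_def x1_def)

lemma relator_commute:
  assumes "word_commutator u v \<in> thompson_relators"
  shows "F.commute (cls u) (cls v)"
proof -
  have "cls (word_commutator u v) = \<one>\<^bsub>thompson_F\<^esub>"
    using pres_eq.relator[OF assms] by (simp add: cls_eq_iff thompson_F_def one_presented_group)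
  then have "(cls u \<otimes>\<^bsub>thompson_F\<^esub> cls v) \<otimes>\<^bsub>thompson_F\<^esub>
      inv\<^bsub>thompson_F\<^esub> (cls v \<otimes>\<^bsub>thompson_F\<^esub> cls u) = \<one>\<^bsub>thompson_F\<^esub>"
    by (simp add: word_commutator_def cls_append cls_word_inv F.inv_mult_group F.m_assoc)
  then show ?thesis
    unfolding F.commute_def
    using F.inv_solve_right'[of "\<one>\<^bsub>thompson_F\<^esub>" "cls u \<otimes>\<^bsub>thompson_F\<^esub> cls v"
        "cls v \<otimes>\<^bsub>thompson_F\<^esub> cls u"] by simp
qed

text \<open>
  The left excursion is \<open>x\<^sub>0 x\<^sub>1\<^sup>-\<^sup>1\<close> conjugated to the far left, and the relators say that
  this element commutes with \<open>x\<^sub>1\<close> shifted by one or two places to the right, hence by any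
  number of places.
\<close>

lemma excursions_commute:
  "cls (left_excursion K @ right_excursion K) = cls (right_excursion K @ left_excursion K)"
proof -
  have shifts: "cls (shifts e n) = cls [(X0, e)] [^]\<^bsub>thompson_F\<^esub> n" for e n
    using cls_concat_replicate[of n "[(X0, e)]"] by simp
  have cons: "cls (y # z # u) = cls [y] \<otimes>\<^bsub>thompson_F\<^esub> cls (z # u)" for y z u
    using cls_append[of "[y]" "z # u"] by simp
  have "word_commutator (word_x0 @ word_inv word_x1) (word_inv word_x0 @ word_x1 @ word_x0)
      \<in> thompson_relators"
    by (simp add: thompson_relators_def)
  from relator_commute[OF this]
  have "F.commute (x0 \<otimes>\<^bsub>thompson_F\<^esub> inv\<^bsub>thompson_F\<^esub> x1) (F.conj_by x0 x1)"
    by (simp add: word_inv_def cons cls_letter F.conj_by_def F.m_assoc)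
  moreover have "word_commutator (word_x0 @ word_inv word_x1)
      (word_inv word_x0 @ word_inv word_x0 @ word_x1 @ word_x0 @ word_x0) \<in> thompson_relators"
    by (simp add: thompson_relators_def)
  from relator_commute[OF this]
  have "F.commute (x0 \<otimes>\<^bsub>thompson_F\<^esub> inv\<^bsub>thompson_F\<^esub> x1)
      (F.conj_by (x0 \<otimes>\<^bsub>thompson_F\<^esub> x0) x1)"
    by (simp add: word_inv_def cons cls_letter F.conj_by_def F.m_assoc F.inv_mult_group)
  ultimately have "F.commute (cls (left_excursion K)) (cls (right_excursion K))"
    using F.thompson_relations_commute[of x0 x1 K K] cls_append[of "[(X1, False)]" "shifts False K"]
    by (simp add: left_excursion_def right_excursion_def cls_append shifts cls_concat_replicate
        cls_letter cons F.m_assoc del: F.nat_pow_Suc replicate_Suc)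
  then show ?thesis
    by (simp add: cls_append F.commute_def)
qed

definition downs_list :: "int \<Rightarrow> nat \<Rightarrow> tree list" where
  "downs_list d n = map (\<lambda>i. Leaf (Root (d - int i))) [0..<n]"

lemma downs_list_Suc:
  "downs_list d (Suc n) = Leaf (Root d) # downs_list (d - 1) n"
  by (simp add: downs_list_def upt_conv_Cons del: upt_Suc flip: map_Suc_upt)

lemma downs_list_snoc: "downs_list d (Suc n) = downs_list d n @ [Leaf (Root (d - int n))]"
  by (simp add: downs_list_def)

lemma downs_shift: "downs d = downs_list d n @- downs (d - int n)"
proof (induction n arbitrary: d)
  case 0
  show ?case by (simp add: downs_list_def)
next
  case (Suc n)
  have "downs d = Leaf (Root d) ## downs (d - 1)" by (rule downs_unfold)
  also have "downs (d - 1) = downs_list (d - 1) n @- downs (d - 1 - int n)" by (rule Suc.IH)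
  finally show ?case by (simp add: downs_list_Suc algebra_simps)
qed

definition carets :: "int \<Rightarrow> nat \<Rightarrow> tree list" where
  "carets e n = map (\<lambda>i. Node (Leaf (Root (e + 2 * int i))) (Leaf (Root (e + 2 * int i + 1)))) [0..<n]"

lemma carets_Suc:
  "carets e (Suc n) = Node (Leaf (Root e)) (Leaf (Root (e + 1))) # carets (e + 2) n"
  by (simp add: carets_def upt_conv_Cons algebra_simps del: upt_Suc flip: map_Suc_upt)

lemma act_shifts_left: "act (ls @- L, R) (shifts True (length ls)) = (L, rev ls @- R)"
  by (induction ls arbitrary: R) simp_all

lemma act_shifts_right: "act (L, rs @- R) (shifts False (length rs)) = (rev rs @- L, R)"
  by (induction rs arbitrary: L) simp_all

lemma act_carets:
  "act (L, ups e) (concat (replicate n [(X0, False), (X1, False)]))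
    = (rev (carets e n) @- L, ups (e + 2 * int n))"
proof (induction n arbitrary: L e)
  case 0
  show ?case by (simp add: carets_def)
next
  case (Suc n)
  have "ups e = Leaf (Root e) ## Leaf (Root (e + 1)) ## ups (2 + e)"
    by (simp add: ups_unfold[of e] ups_unfold[of "e + 1"])
  then have "act (L, ups e) (concat (replicate (Suc n) [(X0, False), (X1, False)]))
      = act (Node (Leaf (Root e)) (Leaf (Root (e + 1))) ## L, ups (2 + e))
          (concat (replicate n [(X0, False), (X1, False)]))"
    by simp
  then show ?case
    by (simp only: Suc.IH) (simp add: carets_Suc algebra_simps)
qed

lemma act_seesaw:
  "act start (seesaw K) =
    ((downs_list 0 K @ [Node (Leaf (Root (- int K - 1))) (Leaf (Root (- int K)))]) @- downs (- 2 - int K),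
     carets 1 K @- ups (1 + 2 * int K))" (is "_ = ((_ @ [?nd]) @- ?L, _)")
proof -
  have "0 - int (Suc K) = - int K - 1" by simp
  then have "downs 0 = downs_list 0 (Suc K) @- downs (- int K - 1)"
    using downs_shift[of 0 "Suc K"] by (simp only:)
  then have "act start (shifts True (Suc K)) = (downs (- int K - 1), rev (downs_list 0 (Suc K)) @- ups 1)"
    using act_shifts_left[of "downs_list 0 (Suc K)"] by (simp add: start_def downs_list_def del: upt_Suc replicate_Suc)
  also have "\<dots> = (Leaf (Root (- int K - 1)) ## ?L, Leaf (Root (- int K)) ## rev (downs_list 0 K) @- ups 1)"
    by (simp add: downs_list_snoc downs_unfold[of "- int K - 1"])
  finally have "act start (shifts True (Suc K) @ [(X1, False)]) = (?nd ## ?L, rev (downs_list 0 K) @- ups 1)"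
    by (simp del: replicate_Suc)
  then have "act start (left_excursion K) = (downs_list 0 K @- ?nd ## ?L, ups 1)"
    using act_shifts_right[of "?nd ## ?L" "rev (downs_list 0 K)" "ups 1"]
    by (simp add: left_excursion_def downs_list_def del: replicate_Suc)
  then show ?thesis
    using act_shifts_left[of "rev (carets 1 K)"]
    by (simp add: seesaw_def right_excursion_def act_carets carets_def)
qed

text \<open>
  The two shapes of trees that the pointer meets near the seesaw position. A light tree costs 2
  at or left of the pointer and 1 right of it, a heavy one 2 and 3: moving away from the middle
  saves 1 per step on both sides.
\<close>

definition light :: "tree \<Rightarrow> bool" where
  "light t \<longleftrightarrow> (\<exists>i\<le>0. t = Leaf (Root i))"

definition heavy :: "tree \<Rightarrow> bool" where
  "heavy t \<longleftrightarrow> (\<exists>i\<ge>1. \<exists>j\<ge>1. t = Node (Leaf (Root i)) (Leaf (Root j)))"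

text \<open>
  \<open>nd\<close> is the caret at the far left, \<open>xs\<close> are the leaves between it and the pointer, and \<open>zs\<close>
  are the carets on the right.
\<close>

lemma seesaw_state:
  obtains xs nd L zs R where
    "act start (seesaw K) = (xs @- nd ## L, zs @- R)"
    "length xs = K" "\<forall>t\<in>set xs. light t" "length zs = K" "\<forall>t\<in>set zs. heavy t"
    "\<forall>a. nd \<noteq> Leaf a" "tree_cost Out_L nd = 4"
proof
  show "act start (seesaw K) = (downs_list 0 K @- Node (Leaf (Root (- int K - 1))) (Leaf (Root (- int K))) ## downs (- 2 - int K),
     carets 1 K @- ups (1 + 2 * int K))"
    by (simp add: act_seesaw)
  show "\<forall>t\<in>set (carets 1 K). heavy t"
    unfolding carets_def heavy_def by fastforce
qed (auto simp: downs_list_def carets_def light_def)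

lemma sum_list_map_const: "\<forall>t\<in>set xs. f t = (c::nat) \<Longrightarrow> sum_list (map f xs) = length xs * c"
  by (induction xs) auto

lemma heavy_cost:
  assumes "\<forall>t\<in>set zs. heavy t"
  shows "sum_list (map (tree_cost Out_L) zs) = length zs * 2" "sum_list (map (tree_cost Out_R) zs) = length zs * 3"
  using assms by (intro sum_list_map_const; auto simp: heavy_def)+

lemma light_cost:
  assumes "\<forall>t\<in>set zs. light t"
  shows "sum_list (map (tree_cost Out_L) zs) = length zs * 2" "sum_list (map (tree_cost Out_R) zs) = length zs"
proof -
  have "\<forall>t\<in>set zs. tree_cost Out_L t = 2" "\<forall>t\<in>set zs. tree_cost Out_R t = 1"
    using assms by (auto simp: light_def)
  from this[THEN sum_list_map_const] show
    "sum_list (map (tree_cost Out_L) zs) = length zs * 2" "sum_list (map (tree_cost Out_R) zs) = length zs"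
    by simp_all
qed

text \<open>
  In the middle the cost is \<open>4\<close> for \<open>nd\<close>, \<open>2 K\<close> for the light trees and \<open>3 K\<close> for the heavy
  ones, which is the length \<open>5 K + 2\<close> plus the 2 for the gap left of the window. The caret \<open>nd\<close>
  on the left and the last heavy tree on the right force every window to be at least this wide.
\<close>

lemma seesaw_shift_state:
  assumes "j \<le> K"
  obtains ls nd L rs R where
    "act start (seesaw K @ shifts e j) = ((ls @ [nd]) @- L, rs @- R)"
    "j < K \<Longrightarrow> ls \<noteq> [] \<and> rs \<noteq> []"
    "\<forall>t\<in>set ls. light t \<or> heavy t" "\<forall>t\<in>set rs. light t \<or> heavy t"
    "rs = [] \<or> heavy (last rs)"
    "\<forall>a. nd \<noteq> Leaf a"
    "window_cost (ls @ [nd]) rs + j = 5 * K + 4"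
proof -
  obtain xs nd L zs R where s: "act start (seesaw K) = (xs @- nd ## L, zs @- R)"
    and xs: "length xs = K" "\<forall>t\<in>set xs. light t" and zs: "length zs = K" "\<forall>t\<in>set zs. heavy t"
    and nd: "\<forall>a. nd \<noteq> Leaf a" "tree_cost Out_L nd = 4"
    using seesaw_state[of K] by metis
  show ?thesis
  proof (cases e)
    case True
    define ys where "ys = take j xs"
    define vs where "vs = drop j xs"
    have v: "xs = ys @ vs" "length ys = j" "length vs = K - j" "\<forall>t\<in>set ys. light t" "\<forall>t\<in>set vs. light t"
      using xs assms by (auto simp: ys_def vs_def dest: in_set_takeD in_set_dropD)
    show ?thesis
    proof (rule that)
      show "act start (seesaw K @ shifts e j) = ((vs @ [nd]) @- L, (rev ys @ zs) @- R)"
        using act_shifts_left[of ys] v by (simp add: s True)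
      show "window_cost (vs @ [nd]) (rev ys @ zs) + j = 5 * K + 4"
        using v zs assms nd by (simp add: window_cost_def heavy_cost light_cost flip: rev_map)
      show "rev ys @ zs = [] \<or> heavy (last (rev ys @ zs))"
        using v zs assms by (cases "zs = []") auto
    qed (use v zs nd in auto)
  next
    case False
    define ys where "ys = take j zs"
    define vs where "vs = drop j zs"
    have v: "zs = ys @ vs" "length ys = j" "length vs = K - j" "\<forall>t\<in>set ys. heavy t" "\<forall>t\<in>set vs. heavy t"
      using zs assms by (auto simp: ys_def vs_def dest: in_set_takeD in_set_dropD)
    show ?thesis
    proof (rule that)
      show "act start (seesaw K @ shifts e j) = (((rev ys @ xs) @ [nd]) @- L, vs @- R)"
        using act_shifts_right[of _ ys] v by (simp add: s False)
      show "window_cost ((rev ys @ xs) @ [nd]) vs + j = 5 * K + 4"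
        using v xs assms nd by (simp add: window_cost_def heavy_cost light_cost flip: rev_map)
      show "vs = [] \<or> heavy (last vs)"
        using v by (cases "vs = []") auto
    qed (use v xs nd in auto)
  qed
qed

lemma heavy_not_leaf: "heavy t \<Longrightarrow> t \<noteq> Leaf a"
  by (auto simp: heavy_def)

lemma seesaw_length_ge:
  assumes "j \<le> K" "pres_eq thompson_relators (seesaw K @ shifts e j) v"
  shows "5 * K + 2 \<le> length v + j"
proof -
  obtain ls nd L rs R where "act start (seesaw K @ shifts e j) = ((ls @ [nd]) @- L, rs @- R)"
    "rs = [] \<or> heavy (last rs)" "\<forall>a. nd \<noteq> Leaf a" and c: "window_cost (ls @ [nd]) rs + j = 5 * K + 4"
    using seesaw_shift_state[OF assms(1), of e] by metis
  with length_ge_window_cost[OF assms(2)] have "window_cost (ls @ [nd]) rs \<le> length v + 2"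
    by (metis heavy_not_leaf last_snoc snoc_eq_iff_butlast)
  with c show ?thesis by linarith
qed

text \<open>
  As long as the pointer has not reached an end, neither \<open>x\<^sub>1\<close> nor its inverse can undo work:
  splitting the current tree, light or heavy, and joining it with a right neighbour of either
  shape both raise the cost by one.
\<close>

lemma seesaw_x1_length_ge:
  assumes "j < K" "pres_eq thompson_relators (seesaw K @ shifts e j @ [(X1, b)]) v"
  shows "5 * K + 3 \<le> length v + j"
proof -
  obtain ls nd L rs R where s: "act start (seesaw K @ shifts e j) = ((ls @ [nd]) @- L, rs @- R)"
    and ne: "ls \<noteq> [] \<and> rs \<noteq> []"
    and lh: "\<forall>t\<in>set ls. light t \<or> heavy t" "\<forall>t\<in>set rs. light t \<or> heavy t"
    and last: "rs = [] \<or> heavy (last rs)" and nd: "\<forall>a. nd \<noteq> Leaf a"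
    and c: "window_cost (ls @ [nd]) rs + j = 5 * K + 4"
    using seesaw_shift_state[of j K e] assms(1) by (metis less_imp_le)
  from ne obtain l ls' r rs' where ls: "ls = l # ls'" and rs: "rs = r # rs'"
    by (meson neq_Nil_conv)
  have l: "light l \<or> heavy l" and r: "light r \<or> heavy r"
    using lh ls rs by auto
  have "window_cost (ls @ [nd]) rs + 1 \<le> length v + 2"
  proof (cases b)
    case True
    have "act start (seesaw K @ shifts e j @ [(X1, b)])
        = ((fst_half l # ls' @ [nd]) @- L, (snd_half l # rs) @- R)"
      using s by (simp add: True ls)
    moreover have "window_cost (fst_half l # ls' @ [nd]) (snd_half l # rs) = window_cost (ls @ [nd]) rs + 1"
      using l by (auto simp: window_cost_def ls light_def heavy_def)
    ultimately show ?thesis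
      using length_ge_window_cost[OF assms(2), of "fst_half l # ls' @ [nd]" L "snd_half l # rs" R] nd last
      by (simp add: rs heavy_not_leaf)
  next
    case False
    have "act start (seesaw K @ shifts e j @ [(X1, b)]) = ((join l r # ls' @ [nd]) @- L, rs' @- R)"
      using s by (simp add: False ls rs)
    moreover have "window_cost (join l r # ls' @ [nd]) rs' = window_cost (ls @ [nd]) rs + 1"
      using l r by (auto simp: window_cost_def ls rs light_def heavy_def)
    ultimately show ?thesis
      using length_ge_window_cost[OF assms(2), of "join l r # ls' @ [nd]" L rs' R] nd last
      by (cases "rs' = []") (simp_all add: rs heavy_not_leaf)
  qed
  with c show ?thesis by linarith
qed

lemma cls_shifts_cancel: "cls (u @ shifts e n @ shifts (\<not> e) n @ v) = cls (u @ v)"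
proof -
  have "word_inv (shifts (\<not> e) n) = shifts e n"
    by (simp add: word_inv_def rev_replicate)
  then have "pres_eq thompson_relators (shifts e n @ shifts (\<not> e) n) []"
    using pres_eq_inv_left by metis
  then show ?thesis
    by (metis append_assoc append_Nil cls_append pres_class_eq_iff)
qed

text \<open>
  Having done the excursions in the order that ends on the side of \<open>e\<close>, the walk need not come all the way back.
\<close>

lemma seesaw_shifts_short:
  assumes "j \<le> K"
  obtains v where "cls v = cls (seesaw K @ shifts e j)" "length v + j = 5 * K + 2"
proof (cases e)
  case True
  let ?v = "concat (replicate K [(X0, False), (X1, False)]) @ shifts True (2 * K + 1) @ [(X1, False)] @ shifts False (K - j)"
  have len: "length (concat (replicate K [(X0, False), (X1, False)])) = 2 * K"
    by (induction K) auto
  have 1: "shifts True (2 * K + 1) = shifts True K @ shifts True (Suc K)"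
    using replicate_add[of K "Suc K" "(X0, True)"] by (simp add: mult_2 del: replicate_Suc)
  have 2: "shifts False K = shifts False (K - j) @ shifts False j"
    using assms by (simp flip: replicate_add)
  have "cls (seesaw K @ shifts e j) = cls ((right_excursion K @ left_excursion K) @ shifts True j)"
    by (simp only: seesaw_def True cls_append[of "_ @ _" "shifts True j"] excursions_commute)
  also have "(right_excursion K @ left_excursion K) @ shifts True j = ?v @ shifts False j @ shifts True j"
    unfolding right_excursion_def left_excursion_def 1 2 by simp
  also have "cls \<dots> = cls ?v"
    using cls_shifts_cancel[of ?v j False "[]"] by simp
  finally show ?thesis
    using that[of ?v] len assms by simp
next
  case False
  let ?v = "left_excursion K @ concat (replicate K [(X0, False), (X1, False)]) @ shifts True (K - j)"
  have len: "length (concat (replicate K [(X0, False), (X1, False)])) = 2 * K"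
    by (induction K) auto
  have 2: "shifts True K = shifts True (K - j) @ shifts True j"
    using assms by (simp flip: replicate_add)
  have "seesaw K @ shifts e j = ?v @ shifts True j @ shifts False j"
    unfolding seesaw_def right_excursion_def 2 by (simp add: False)
  also have "cls \<dots> = cls ?v"
    using cls_shifts_cancel[of ?v j True "[]"] by simp
  finally show ?thesis
    using that[of ?v] len assms by (simp add: left_excursion_def)
qed

section \<open>Geodesics near a seesaw word\<close>

lemma cls_snoc_move:
  assumes "cls (v @ [(a, b)]) = cls u"
  shows "cls v = cls (u @ [(a, \<not> b)])"
proof -
  have "cls (v @ [(a, b), (a, \<not> b)]) = cls (v @ [])"
    unfolding cls_eq_iff by (intro pres_eq.append pres_eq.refl pres_eq.cancel)
  then have "cls v = cls ((v @ [(a, b)]) @ [(a, \<not> b)])" by simp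
  also have "\<dots> = cls (u @ [(a, \<not> b)])"
    using assms by (simp only: cls_append)
  finally show ?thesis .
qed

text \<open>
  The last letter of a geodesic leads away from an element of smaller length. At \<open>w x\<^sub>0\<^sup>\<plusminus>\<^sup>j\<close>
  this leaves only the neighbour one step further out; in the middle, for \<open>j = 0\<close>, there is one
  on each side.
\<close>

lemma seesaw_geodesic_step:
  assumes "j < K" "cls v = cls (seesaw K @ shifts e j)" "length v + j = 5 * K + 2"
  obtains v' y e' where "v = v' @ [y]" "cls v' = cls (seesaw K @ shifts e' (Suc j))" "j = 0 \<or> e' = e"
proof -
  from assms have "v \<noteq> []" by auto
  then obtain v' a b where v: "v = v' @ [(a, b)]"
    by (metis rev_exhaust surj_pair)
  have eq: "cls v' = cls (seesaw K @ shifts e j @ [(a, \<not> b)])"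
    using cls_snoc_move[of v' a b] assms(2) by (simp add: v)
  have "a = X0"
  proof (rule ccontr)
    assume "a \<noteq> X0"
    then have "a = X1" by (cases a) auto
    with eq have "5 * K + 3 \<le> length v' + j"
      by (intro seesaw_x1_length_ge[of j K e "\<not> b"]) (use assms(1) in \<open>simp_all flip: cls_eq_iff\<close>)
    with assms(3) v show False by simp
  qed
  show ?thesis
  proof (cases "j = 0 \<or> e = (\<not> b)")
    case True
    then have "shifts e j @ [(a, \<not> b)] = shifts (\<not> b) (Suc j)"
      using \<open>a = X0\<close> by (auto simp: replicate_append_same)
    with eq True show ?thesis using that[OF v] by metis
  next
    case False
    then obtain i where j: "j = Suc i" and b: "b = e" by (cases j) auto
    have "shifts e j @ [(a, \<not> b)] = shifts e i @ shifts e 1 @ shifts (\<not> e) 1"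
      using \<open>a = X0\<close> by (simp add: j b replicate_append_same flip: append_Cons)
    then have "cls v' = cls (seesaw K @ shifts e i)"
      using eq cls_shifts_cancel[of "seesaw K @ shifts e i" 1 e "[]"] by simp
    then have "5 * K + 2 \<le> length v' + i"
      by (intro seesaw_length_ge[of i K e]) (use assms(1) j in \<open>simp_all flip: cls_eq_iff\<close>)
    with assms(3) v j show ?thesis by simp
  qed
qed

text \<open>
  Here \<open>4 K + 2\<close> is the length at the end of the seesaw. Once \<open>j > 0\<close> the side is decided, and
  reading the geodesic backwards leads in the same direction until that end is reached.
\<close>

lemma seesaw_geodesic_prefix:
  assumes "0 < j" "j \<le> K" "cls v = cls (seesaw K @ shifts e j)" "length v + j = 5 * K + 2"
  shows "cls (take (4 * K + 2) v) = cls (seesaw K @ shifts e K)"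
  using assms(2,1,3,4)
proof (induction j arbitrary: v rule: inc_induct)
  case base
  then show ?case by simp
next
  case (step j)
  obtain v' y where v: "v = v' @ [y]" and eq: "cls v' = cls (seesaw K @ shifts e (Suc j))"
    using seesaw_geodesic_step[of j K v e] step by blast
  then have "cls (take (4 * K + 2) v') = cls (seesaw K @ shifts e K)"
    using step by simp
  moreover have "take (4 * K + 2) v = take (4 * K + 2) v'"
    using step v by simp
  ultimately show ?case by simp
qed

lemma seesaw_geodesic_prefix_0:
  assumes "0 < K" "cls v = cls (seesaw K)" "length v = 5 * K + 2"
  obtains e where "cls (take (4 * K + 2) v) = cls (seesaw K @ shifts e K)"
proof -
  have "cls v = cls (seesaw K @ shifts True 0)" "length v + 0 = 5 * K + 2"
    using assms by simp_all
  from seesaw_geodesic_step[OF assms(1) this]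
  obtain v' y e where v: "v = v' @ [y]" and eq: "cls v' = cls (seesaw K @ shifts e (Suc 0))"
    by metis
  have "cls (take (4 * K + 2) v') = cls (seesaw K @ shifts e K)"
    by (rule seesaw_geodesic_prefix[OF _ _ eq]) (use assms v in auto)
  moreover have "take (4 * K + 2) v = take (4 * K + 2) v'"
    using assms v by simp
  ultimately show ?thesis using that by metis
qed

section \<open>Words and the Cayley graph\<close>

text \<open>
  The exponent sum of \<open>x\<^sub>0\<close> is invariant, since the relators are commutators. It shows that
  powers of \<open>x\<^sub>0\<close> are geodesic, which is what separates the two ends of a seesaw.
\<close>

definition x0_exponent :: "thompson_gen gword \<Rightarrow> int" where
  "x0_exponent u = (\<Sum>(a, b)\<leftarrow>u. if a = X0 then if b then 1 else - 1 else 0)"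

lemma x0_exponent_simps [simp]:
  "x0_exponent [] = 0"
  "x0_exponent ((a, b) # u) = (if a = X0 then if b then 1 else - 1 else 0) + x0_exponent u"
  "x0_exponent (u @ v) = x0_exponent u + x0_exponent v"
  by (simp_all add: x0_exponent_def)

lemma x0_exponent_pres_eq: "pres_eq thompson_relators u v \<Longrightarrow> x0_exponent u = x0_exponent v"
  by (induction rule: pres_eq.induct)
    (auto simp: thompson_relators_def word_commutator_def word_inv_def)

lemma sym_gens_letters: "sym_gens thompson_F {x0, x1} = range (\<lambda>y. cls [y])"
proof (intro equalityI subsetI)
  fix g assume "g \<in> sym_gens thompson_F {x0, x1}"
  then have "g \<in> {cls [(X0, True)], cls [(X0, False)], cls [(X1, True)], cls [(X1, False)]}"
    unfolding cls_letter by (auto simp: sym_gens_def)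
  then show "g \<in> range (\<lambda>y. cls [y])" by blast
next
  fix g assume "g \<in> range (\<lambda>y. cls [y])"
  then obtain a b where "g = cls [(a, b)]" by auto
  then show "g \<in> sym_gens thompson_F {x0, x1}"
    by (cases a; cases b) (auto simp: sym_gens_def cls_letter)
qed

lemma cayley_adj_cls: "cayley_adj thompson_F {x0, x1} (cls u) w \<longleftrightarrow> (\<exists>y. w = cls (u @ [y]))"
  by (auto simp: cayley_adj_def sym_gens_letters cls_append)

lemma cayley_walk_cls:
  "(cayley_adj thompson_F {x0, x1} ^^ n) (cls u) w \<longleftrightarrow> (\<exists>v. length v = n \<and> w = cls (u @ v))"
proof (induction n arbitrary: w)
  case 0
  show ?case by auto
next
  case (Suc n)
  have "(cayley_adj thompson_F {x0, x1} ^^ Suc n) (cls u) w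
      \<longleftrightarrow> (\<exists>v. length v = n \<and> cayley_adj thompson_F {x0, x1} (cls (u @ v)) w)"
    by (auto simp: OO_def Suc.IH)
  also have "\<dots> \<longleftrightarrow> (\<exists>v y. length v = n \<and> w = cls (u @ v @ [y]))"
    by (simp add: cayley_adj_cls)
  also have "\<dots> \<longleftrightarrow> (\<exists>v. length v = Suc n \<and> w = cls (u @ v))"
    by (metis length_append_singleton length_Suc_conv_rev)
  finally show ?case .
qed

lemma x0_exponent_le_length: "\<bar>x0_exponent u\<bar> \<le> int (length u)"
  by (induction u) auto

lemma cayley_dist_shifts: "cayley_dist thompson_F {x0, x1} (cls u) (cls (u @ shifts e n)) = n"
  unfolding cayley_dist_def cayley_walk_cls
proof (rule Least_equality)
  show "\<exists>v. length v = n \<and> cls (u @ shifts e n) = cls (u @ v)"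
    by (rule exI[of _ "shifts e n"]) simp
next
  fix m assume "\<exists>v. length v = m \<and> cls (u @ shifts e n) = cls (u @ v)"
  then obtain v where v: "length v = m" "cls (u @ shifts e n) = cls (u @ v)"
    by blast
  from v(2) have "x0_exponent (u @ shifts e n) = x0_exponent (u @ v)"
    unfolding cls_eq_iff by (rule x0_exponent_pres_eq)
  then have "x0_exponent (shifts e n) = x0_exponent v" by simp
  moreover have "x0_exponent (shifts e n) = (if e then int n else - int n)"
    by (induction n) auto
  ultimately show "n \<le> m"
    using v(1) x0_exponent_le_length[of v] by (simp split: if_splits)
qed

lemma list_prod_letters: "list_prod thompson_F (map (\<lambda>y. cls [y]) u) = cls u"
proof (induction u)
  case Nil
  show ?case by (simp add: list_prod_def thompson_F_def one_presented_group)
next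
  case (Cons y u)
  then show ?case using cls_append[of "[y]" u] by (simp add: list_prod_def)
qed

text \<open>
  A geodesic path is a list of group elements; choosing a letter for each of them turns it into a shortest word.
\<close>

lemma geodesic_word:
  assumes "geodesic_to thompson_F {x0, x1} (cls u) gs"
  obtains v where "cls v = cls u" "\<And>v'. cls v' = cls u \<Longrightarrow> length v \<le> length v'"
    "\<And>i. path_at thompson_F gs i = cls (take i v)"
proof -
  have "set gs \<subseteq> range (\<lambda>y. cls [y])"
    using assms by (simp add: geodesic_to_def path_to_def sym_gens_letters)
  then have "\<exists>v. gs = map (\<lambda>y. cls [y]) v"
    unfolding ex_map_conv by blast
  then obtain v where gs: "gs = map (\<lambda>y. cls [y]) v" ..
  show ?thesis
  proof (rule that)
    show "cls v = cls u"
      using assms by (simp add: geodesic_to_def path_to_def gs list_prod_letters)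
    show "path_at thompson_F gs i = cls (take i v)" for i
      by (simp add: path_at_def gs take_map list_prod_letters)
    fix v' assume "cls v' = cls u"
    then have "path_to thompson_F {x0, x1} (cls u) (map (\<lambda>y. cls [y]) v')"
      by (auto simp: path_to_def sym_gens_letters list_prod_letters)
    then have "word_length thompson_F {x0, x1} (cls u) \<le> length v'"
      unfolding word_length_def by (intro Least_le) (metis length_map)
    then show "length v \<le> length v'"
      using assms by (simp add: geodesic_to_def gs)
  qed
qed

lemma seesaw_geodesic_word:
  assumes "j \<le> K" "geodesic_to thompson_F {x0, x1} (cls (seesaw K @ shifts e j)) gs"
  obtains v where "cls v = cls (seesaw K @ shifts e j)" "length v + j = 5 * K + 2"
    "\<And>i. path_at thompson_F gs i = cls (take i v)"
proof -
  obtain v where v: "cls v = cls (seesaw K @ shifts e j)"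
    and min: "\<And>v'. cls v' = cls (seesaw K @ shifts e j) \<Longrightarrow> length v \<le> length v'"
    and at: "\<And>i. path_at thompson_F gs i = cls (take i v)"
    using geodesic_word[OF assms(2)] by blast
  obtain v' where "cls v' = cls (seesaw K @ shifts e j)" "length v' + j = 5 * K + 2"
    by (rule seesaw_shifts_short[OF assms(1)])
  with min[of v'] have "length v + j \<le> 5 * K + 2" by simp
  moreover have "5 * K + 2 \<le> length v + j"
    by (rule seesaw_length_ge[OF assms(1)]) (use v in \<open>simp flip: cls_eq_iff\<close>)
  ultimately show ?thesis using that v at by simp
qed

section \<open>No combing by geodesics\<close>

theorem theorem4p2: "\<not> combable_by_geodesics thompson_F {x0, x1}"
proof
  assume "combable_by_geodesics thompson_F {x0, x1}"
  then obtain k \<gamma> where geo: "\<And>u. geodesic_to thompson_F {x0, x1} (cls u) (\<gamma> (cls u))"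
    and ft: "fellow_traveller_property thompson_F {x0, x1} k \<gamma>"
    unfolding combable_by_geodesics_def by (metis cls_closed)
  \<comment> \<open>any \<open>K\<close> with \<open>k < 2 K\<close> and \<open>0 < K\<close> works\<close>
  define K where "K = Suc k"
  let ?w = "cls (seesaw K)" and ?N = "4 * K + 2"
  have geo0: "geodesic_to thompson_F {x0, x1} (cls (seesaw K @ shifts True 0)) (\<gamma> ?w)"
    using geo[of "seesaw K"] by simp
  obtain v where "cls v = cls (seesaw K @ shifts True 0)" "length v + 0 = 5 * K + 2"
    and at_v: "\<And>i. path_at thompson_F (\<gamma> ?w) i = cls (take i v)"
    using seesaw_geodesic_word[OF le0 geo0] by metis
  then have "0 < K" "cls v = cls (seesaw K)" "length v = 5 * K + 2"
    by (simp_all add: K_def)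
  from seesaw_geodesic_prefix_0[OF this]
  obtain e where e: "cls (take ?N v) = cls (seesaw K @ shifts e K)" by metis
  \<comment> \<open>the neighbour of \<open>w\<close> on the side that the chosen geodesic to \<open>w\<close> does not visit\<close>
  let ?w' = "cls (seesaw K @ shifts (\<not> e) 1)"
  have K: "1 \<le> K" by (simp add: K_def)
  obtain v' where v': "cls v' = ?w'" "length v' + 1 = 5 * K + 2"
    and at_v': "\<And>i. path_at thompson_F (\<gamma> ?w') i = cls (take i v')"
    using seesaw_geodesic_word[OF K geo] by metis
  have e': "cls (take ?N v') = cls (seesaw K @ shifts (\<not> e) K)"
    by (rule seesaw_geodesic_prefix[OF _ K v']) simp
  have "cls (seesaw K @ shifts (\<not> e) K) = cls ((seesaw K @ shifts e K) @ shifts (\<not> e) (2 * K))"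
    using cls_shifts_cancel[of "seesaw K" K e "shifts (\<not> e) K"] by (simp add: mult_2 replicate_add)
  then have "cayley_dist thompson_F {x0, x1} (path_at thompson_F (\<gamma> ?w) ?N) (path_at thompson_F (\<gamma> ?w') ?N) = 2 * K"
    by (simp only: at_v at_v' e e' cayley_dist_shifts)
  moreover have "cayley_dist thompson_F {x0, x1} (path_at thompson_F (\<gamma> ?w) ?N) (path_at thompson_F (\<gamma> ?w') ?N)
      \<le> sync_dist thompson_F {x0, x1} (\<gamma> ?w) (\<gamma> ?w')"
    unfolding sync_dist_def by (rule Max_ge[OF finite_sync_dist]) (simp add: image_iff, force)
  moreover have "sync_dist thompson_F {x0, x1} (\<gamma> ?w) (\<gamma> ?w') \<le> k"
    using ft cayley_dist_shifts[of "seesaw K" 1 "\<not> e"] unfolding fellow_traveller_property_def by simp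
  ultimately show False by (simp add: K_def)
qed

end
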